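(* Let $G$ be an $(n,d,\lambda)$-graph with $d=o(n)$, and let $U\subset V(G)$ be a set of vertices. Assume that: (1) given any three vertices $v_1,v_2,v_3\in U$, there exist three vertices $u_1,u_2,u_3\in U$ such that $u_i\sim v_j$ if and only if $i=j$; (2) $|U|\ge C\max\left\{\lambda^{2/3}(n/d)^2,\ \lambda (n/d)^{13/7}\right\}$, where $C$ is a (sufficiently large) absolute constant. Then the VC-dimension of $\mathcal{H}(U)$ is at least $3$.
   Context: An $(n,d,\lambda)$-graph is a $d$-regular graph on $n$ vertices all of whose adjacency eigenvalues other than the largest have absolute value at most $\lambda$. We write $u\sim v$ if $u$ and $v$ are adjacent. Asymptotic notation refers to a sequence of such graphs with $n\to\infty$. For $U\subset V(G)$ and $v\in U$, let $h_v\colon U\to\{0,1\}$ be given by $h_v(u)=1$ if $u\sim v$ and $h_v(u)=0$ otherwise ($u\in U$), and $\mathcal{H}(U)=\{h_v: v\in U\}$. A collection $\mathcal{H}$ of functions $V\to\{0,1\}$ shatters a finite set $X\subset V$ if the restrictions of the functions in $\mathcal{H}$ to $X$ give every function $X\to\{0,1\}$; the VC-dimension of $\mathcal{H}$ is the largest size of a set shattered by $\mathcal{H}$. *)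

theory Defs
  imports
    "Jordan_Normal_Form.Char_Poly"
    "HOL-Library.Extended_Nat"
    "HOL-Library.FuncSet"
    "HOL-Library.Landau_Symbols"
begin

text \<open>
  A graph on \<open>n\<close> vertices is represented with vertex set \<open>{..<n}\<close> and an adjacency relation on it.
\<close>

definition simple_graph :: "nat \<Rightarrow> (nat \<Rightarrow> nat \<Rightarrow> bool) \<Rightarrow> bool" where
  "simple_graph n adj \<longleftrightarrow>
     (\<forall>u v. adj u v \<longrightarrow> u < n \<and> v < n \<and> u \<noteq> v) \<and>
     (\<forall>u v. adj u v \<longrightarrow> adj v u)"

definition regular_graph :: "nat \<Rightarrow> nat \<Rightarrow> (nat \<Rightarrow> nat \<Rightarrow> bool) \<Rightarrow> bool" where
  "regular_graph n d adj \<longleftrightarrow> simple_graph n adj \<and> (\<forall>v<n. card {u. adj v u} = d)"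

definition adjacency_mat :: "nat \<Rightarrow> (nat \<Rightarrow> nat \<Rightarrow> bool) \<Rightarrow> real mat" where
  "adjacency_mat n adj = mat n n (\<lambda>(i, j). if adj i j then 1 else 0)"

text \<open>
  Eigenvalues are counted with multiplicity. The matrix is real symmetric, so its characteristic
  polynomial splits over the reals and the multiset of real roots contains all \<open>n\<close> eigenvalues.
\<close>

definition adjacency_eigenvalues :: "nat \<Rightarrow> (nat \<Rightarrow> nat \<Rightarrow> bool) \<Rightarrow> real multiset" where
  "adjacency_eigenvalues n adj = proots (char_poly (adjacency_mat n adj))"

text \<open>
  Only one copy of the largest eigenvalue is exempt from the bound: if it is repeated (as for
  disconnected graphs), it must itself be at most \<open>l\<close> in absolute value.
\<close>

definition ndl_graph :: "nat \<Rightarrow> nat \<Rightarrow> real \<Rightarrow> (nat \<Rightarrow> nat \<Rightarrow> bool) \<Rightarrow> bool" where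
  "ndl_graph n d l adj \<longleftrightarrow> regular_graph n d adj \<and>
     (\<forall>\<mu> \<in># adjacency_eigenvalues n adj - {#Max_mset (adjacency_eigenvalues n adj)#}. \<bar>\<mu>\<bar> \<le> l)"

text \<open>
  Functions \<open>V \<rightarrow> {0, 1}\<close> are elements of \<open>V \<rightarrow>\<^sub>E {0, 1}\<close>, that is, undefined outside \<open>V\<close>.
\<close>

definition nbr_fun :: "(nat \<Rightarrow> nat \<Rightarrow> bool) \<Rightarrow> nat set \<Rightarrow> nat \<Rightarrow> nat \<Rightarrow> nat" where
  "nbr_fun adj U v = (\<lambda>u\<in>U. if adj u v then 1 else 0)"

definition nbr_class :: "(nat \<Rightarrow> nat \<Rightarrow> bool) \<Rightarrow> nat set \<Rightarrow> (nat \<Rightarrow> nat) set" where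
  "nbr_class adj U = nbr_fun adj U ` U"

definition shatters :: "('a \<Rightarrow> nat) set \<Rightarrow> 'a set \<Rightarrow> bool" where
  "shatters H X \<longleftrightarrow> (\<lambda>h. restrict h X) ` H = X \<rightarrow>\<^sub>E {0, 1}"

text \<open>
  The supremum in \<open>enat\<close> is infinite if arbitrarily large finite sets are shattered, and \<open>0\<close> if
  no set is shattered (which happens only for empty \<open>H\<close>).
\<close>

definition vc_dim :: "'a set \<Rightarrow> ('a \<Rightarrow> nat) set \<Rightarrow> enat" where
  "vc_dim V H = Sup {enat (card X) | X. finite X \<and> X \<subseteq> V \<and> shatters H X}"

end

theory Submission
  imports
    Defs
    "HOL-Library.Indicator_Function"
    "Jordan_Normal_Form.Spectral_Radius"
begin

text \<open>
  Write \<open>p = d / n\<close> and \<open>N = |U|\<close>. The deflated matrix \<open>A - p J\<close> has operator norm at most \<open>\<lambda>\<close>,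
  so \<open>\<Sum>\<^sub>u (|N(u) \<inter> W| - p |W|)\<^sup>2 \<le> \<lambda>\<^sup>2 |W|\<close> for every vertex set \<open>W\<close>; this is the only use of the
  spectrum. All but few vertices of \<open>U\<close> have about \<open>p N\<close> neighbours in \<open>U\<close>, which gives on the
  order of \<open>p\<^sup>3 N\<^sup>4\<close> quadruples \<open>(y, a, b, c)\<close> in \<open>U\<close> with \<open>y\<close> adjacent to the typical vertices
  \<open>a, b, c\<close>. By hypothesis (1) such a triple can fail to be shattered only if the common
  neighbourhood \<open>S\<close> in \<open>U\<close> of two of its members lies in the neighbourhood of the third. Given the
  two, there are \<open>|S|\<close> choices of \<open>y\<close> and, by the discrepancy bound for \<open>W = S\<close>, only
  \<open>O(\<lambda>\<^sup>2 / |S|)\<close> of the third vertex, hence \<open>O(\<lambda>\<^sup>2 N\<^sup>2)\<close> bad quadruples. So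
  \<open>N \<ge> C \<lambda> p\<^bsup>-3/2\<^esup>\<close> suffices, and this follows from the second term of the maximum.
\<close>

section \<open>Real symmetric matrices\<close>

lemma bounded_convex_sequence_decseq:
  fixes a :: "nat \<Rightarrow> real"
  assumes convex: "\<And>k. 2 * a (Suc k) \<le> a k + a (Suc (Suc k))"
    and bounded: "\<And>k. a k \<le> K"
  shows "decseq a"
proof (intro decseq_SucI leI notI)
  fix m assume "a m < a (Suc m)"
  hence pos: "a (Suc m) - a m > 0" by simp
  have step: "a (Suc (m + k)) - a (m + k) \<ge> a (Suc m) - a m" for k
  proof (induction k)
    case (Suc k)
    thus ?case using convex[of "m + k"] by simp
  qed simp
  have linear: "a (m + k) \<ge> a m + real k * (a (Suc m) - a m)" for k
  proof (induction k)
    case (Suc k)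
    thus ?case using step[of k] by (simp add: algebra_simps)
  qed simp
  obtain k where "real k * (a (Suc m) - a m) > K - a m"
    using reals_Archimedean3[OF pos] by blast
  thus False using linear[of k] bounded[of "m + k"] by simp
qed

lemma symmetric_mat_scalar_prod:
  fixes S :: "'a :: comm_semiring_0 mat"
  assumes "S \<in> carrier_mat n n" "S\<^sup>T = S" "x \<in> carrier_vec n" "y \<in> carrier_vec n"
  shows "(S *\<^sub>v x) \<bullet> y = x \<bullet> (S *\<^sub>v y)"
  using transpose_vec_mult_scalar[of S n n y x] assms
  by (metis comm_scalar_prod mult_mat_vec_carrier)

lemma real_symmetric_complex_eigenvalue:
  fixes S :: "real mat"
  assumes S: "S \<in> carrier_mat n n" and sym: "S\<^sup>T = S"
    and ev: "eigenvalue (map_mat complex_of_real S) z"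
  obtains x where "z = complex_of_real x" "eigenvalue S x"
proof -
  let ?S = "map_mat complex_of_real S"
  have SC: "?S \<in> carrier_mat n n" using S by simp
  obtain v where v: "v \<in> carrier_vec n" "v \<noteq> 0\<^sub>v n" "?S *\<^sub>v v = z \<cdot>\<^sub>v v"
    using ev S unfolding eigenvalue_def eigenvector_def by auto
  have cv: "conjugate v \<in> carrier_vec n" using v(1) by simp
  have symC: "?S\<^sup>T = ?S" using sym by (simp add: map_mat_transpose)
  have "?S *\<^sub>v conjugate v = conjugate (?S *\<^sub>v v)"
    using S v(1) by (intro eq_vecI) (auto simp: scalar_prod_def)
  also have "\<dots> = cnj z \<cdot>\<^sub>v conjugate v" by (simp add: v(3) conjugate_smult_vec)
  finally have Scv: "?S *\<^sub>v conjugate v = cnj z \<cdot>\<^sub>v conjugate v" .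
  have "z * (v \<bullet> conjugate v) = (?S *\<^sub>v v) \<bullet> conjugate v" using v cv by simp
  also have "\<dots> = v \<bullet> (?S *\<^sub>v conjugate v)"
    by (rule symmetric_mat_scalar_prod[OF SC symC v(1) cv])
  also have "\<dots> = cnj z * (v \<bullet> conjugate v)" using v(1) cv by (simp add: Scv)
  finally have "cnj z = z"
    using conjugate_square_eq_0_vec[OF v(1)] v(2) by simp
  then obtain x where x: "z = complex_of_real x"
    by (metis Reals_cnj_iff Reals_cases)
  have "poly (char_poly ?S) z = 0" using ev eigenvalue_root_char_poly[OF SC] by simp
  hence "poly (char_poly S) x = 0"
    using x S by (simp add: of_real_hom.char_poly_hom of_real_hom.poly_map_poly)
  thus ?thesis using that x eigenvalue_root_char_poly[OF S] by blast
qed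

lemma symmetric_mat_power_bounded:
  fixes S :: "real mat"
  assumes S: "S \<in> carrier_mat n n" and sym: "S\<^sup>T = S"
    and ev: "\<And>x. eigenvalue S x \<Longrightarrow> \<bar>x\<bar> < 1"
  obtains c where "\<And>k. norm_bound (S ^\<^sub>m k) c"
proof (cases "n = 0")
  case True
  hence "norm_bound (S ^\<^sub>m k) 0" for k using S by (intro norm_boundI) auto
  thus ?thesis by (rule that)
next
  case False
  let ?S = "map_mat complex_of_real S"
  have SC: "?S \<in> carrier_mat n n" using S by simp
  have "spectral_radius ?S \<in> norm ` spectrum ?S"
    using spectral_radius_mem_max(1)[OF SC] False by simp
  then obtain z where "eigenvalue ?S z" "spectral_radius ?S = norm z"
    unfolding spectrum_def by auto
  hence "spectral_radius ?S < 1"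
    using ev by (metis real_symmetric_complex_eigenvalue[OF S sym] norm_of_real)
  then obtain c where c: "\<And>k. norm_bound (?S ^\<^sub>m k) c"
    using spectral_radius_jnf_norm_bound_less_1_upper_triangular[OF SC] by blast
  have "?S ^\<^sub>m k = map_mat complex_of_real (S ^\<^sub>m k)" for k
    by (rule of_real_hom.mat_hom_pow[OF S, symmetric])
  hence "norm_bound (S ^\<^sub>m k) c" for k
    using c[of k] unfolding norm_bound_def by simp
  thus ?thesis by (rule that)
qed

lemma funpow_mult_mat_vec:
  fixes A :: "'a :: semiring_1 mat"
  assumes A: "A \<in> carrier_mat n n" and v: "v \<in> carrier_vec n"
  shows "((*\<^sub>v) A ^^ k) v = A ^\<^sub>m k *\<^sub>v v"
  using v
proof (induction k arbitrary: v)
  case (Suc k)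
  have "((*\<^sub>v) A ^^ Suc k) v = ((*\<^sub>v) A ^^ k) (A *\<^sub>v v)" by (simp only: funpow_Suc_right o_apply)
  also have "\<dots> = A ^\<^sub>m k *\<^sub>v (A *\<^sub>v v)" using A Suc by simp
  also have "\<dots> = A ^\<^sub>m Suc k *\<^sub>v v"
    using assoc_mult_mat_vec[OF pow_carrier_mat[OF A] A Suc.prems] by simp
  finally show ?case .
qed (use A in simp)

lemma norm_bound_mult_mat_vec_sq_le:
  fixes M :: "real mat"
  assumes M: "M \<in> carrier_mat m n" and c: "norm_bound M c" and v: "v \<in> carrier_vec n"
  shows "(M *\<^sub>v v) \<bullet> (M *\<^sub>v v) \<le> real m * (c * (\<Sum>j<n. \<bar>v $ j\<bar>))\<^sup>2"
proof -
  have "\<bar>(M *\<^sub>v v) $ i\<bar> \<le> c * (\<Sum>j<n. \<bar>v $ j\<bar>)" if i: "i < m" for i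
  proof -
    have "\<bar>(M *\<^sub>v v) $ i\<bar> = \<bar>\<Sum>j<n. M $$ (i, j) * v $ j\<bar>"
      using M v i by (simp add: scalar_prod_def atLeast0LessThan)
    also have "\<dots> \<le> (\<Sum>j<n. \<bar>M $$ (i, j) * v $ j\<bar>)" by (rule sum_abs)
    also have "\<dots> \<le> (\<Sum>j<n. c * \<bar>v $ j\<bar>)"
      using c M i by (intro sum_mono) (auto simp: norm_bound_def abs_mult intro!: mult_right_mono)
    finally show ?thesis by (simp add: sum_distrib_left)
  qed
  hence "((M *\<^sub>v v) $ i)\<^sup>2 \<le> (c * (\<Sum>j<n. \<bar>v $ j\<bar>))\<^sup>2" if "i < m" for i
    using that by (metis abs_ge_zero power2_abs power_mono)
  hence "(\<Sum>i<m. ((M *\<^sub>v v) $ i)\<^sup>2) \<le> (\<Sum>i<m. (c * (\<Sum>j<n. \<bar>v $ j\<bar>))\<^sup>2)"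
    by (intro sum_mono) simp
  thus ?thesis
    using M by (simp add: scalar_prod_def atLeast0LessThan power2_eq_square del: index_mult_mat_vec)
qed

lemma symmetric_mat_sq_norm_convex:
  fixes S :: "real mat"
  assumes S: "S \<in> carrier_mat n n" and sym: "S\<^sup>T = S" and v: "v \<in> carrier_vec n"
  shows "2 * ((S *\<^sub>v v) \<bullet> (S *\<^sub>v v)) \<le> v \<bullet> v + (S *\<^sub>v (S *\<^sub>v v)) \<bullet> (S *\<^sub>v (S *\<^sub>v v))"
proof -
  let ?w = "S *\<^sub>v (S *\<^sub>v v)"
  have w: "?w \<in> carrier_vec n" using S v by simp
  have "0 \<le> (v - ?w) \<bullet> (v - ?w)" by (simp add: scalar_prod_def sum_nonneg)
  also have "\<dots> = v \<bullet> v - 2 * (v \<bullet> ?w) + ?w \<bullet> ?w"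
    using v w comm_scalar_prod[OF v w]
    by (simp add: minus_scalar_prod_distrib[of _ n] scalar_prod_minus_distrib[of _ n])
  also have "v \<bullet> ?w = (S *\<^sub>v v) \<bullet> (S *\<^sub>v v)"
    using S v by (intro symmetric_mat_scalar_prod[OF S sym, symmetric]) auto
  finally show ?thesis by simp
qed

lemma symmetric_mat_contraction:
  fixes S :: "real mat"
  assumes S: "S \<in> carrier_mat n n" and sym: "S\<^sup>T = S"
    and ev: "\<And>x. eigenvalue S x \<Longrightarrow> \<bar>x\<bar> < 1"
    and v: "v \<in> carrier_vec n"
  shows "(S *\<^sub>v v) \<bullet> (S *\<^sub>v v) \<le> v \<bullet> v"
proof -
  define w where "w k = ((*\<^sub>v) S ^^ k) v" for k
  have w: "w k = S ^\<^sub>m k *\<^sub>v v" for k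
    unfolding w_def by (rule funpow_mult_mat_vec[OF S v])
  obtain c where "\<And>k. norm_bound (S ^\<^sub>m k) c"
    using symmetric_mat_power_bounded[OF S sym ev] by blast
  hence "w k \<bullet> w k \<le> real n * (c * (\<Sum>j<n. \<bar>v $ j\<bar>))\<^sup>2" for k
    unfolding w using S v by (intro norm_bound_mult_mat_vec_sq_le) auto
  moreover have "2 * (w (Suc k) \<bullet> w (Suc k)) \<le> w k \<bullet> w k + w (Suc (Suc k)) \<bullet> w (Suc (Suc k))" for k
  proof -
    have "w k \<in> carrier_vec n" unfolding w using S v by (intro mult_mat_vec_carrier) auto
    thus ?thesis using symmetric_mat_sq_norm_convex[OF S sym] by (simp add: w_def)
  qed
  ultimately have "decseq (\<lambda>k. w k \<bullet> w k)" by (intro bounded_convex_sequence_decseq)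
  hence "w 1 \<bullet> w 1 \<le> w 0 \<bullet> w 0" by (rule decseqD) simp
  thus ?thesis by (simp add: w_def)
qed

lemma eigenvalue_smult_mat:
  fixes A :: "'a :: field mat"
  assumes A: "A \<in> carrier_mat n n" and c: "c \<noteq> 0" and ev: "eigenvalue (c \<cdot>\<^sub>m A) x"
  shows "eigenvalue A (x / c)"
proof -
  obtain w where w: "w \<in> carrier_vec n" "w \<noteq> 0\<^sub>v n" "(c \<cdot>\<^sub>m A) *\<^sub>v w = x \<cdot>\<^sub>v w"
    using ev A unfolding eigenvalue_def eigenvector_def by auto
  have "A *\<^sub>v w = (1 / c) \<cdot>\<^sub>v ((c \<cdot>\<^sub>m A) *\<^sub>v w)" using c A w(1) by (intro eq_vecI) auto
  also have "\<dots> = (x / c) \<cdot>\<^sub>v w" using w(1) by (simp add: w(3) smult_smult_assoc)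
  finally show ?thesis using A w unfolding eigenvalue_def eigenvector_def by auto
qed

lemma symmetric_mat_sq_norm_le:
  fixes S :: "real mat"
  assumes S: "S \<in> carrier_mat n n" and sym: "S\<^sup>T = S" and L: "L \<ge> 0"
    and ev: "\<And>x. eigenvalue S x \<Longrightarrow> \<bar>x\<bar> \<le> L"
    and v: "v \<in> carrier_vec n"
  shows "(S *\<^sub>v v) \<bullet> (S *\<^sub>v v) \<le> L\<^sup>2 * (v \<bullet> v)"
proof (rule tendsto_lowerbound)
  show "((\<lambda>t. t\<^sup>2 * (v \<bullet> v)) \<longlongrightarrow> L\<^sup>2 * (v \<bullet> v)) (at_right L)"
    by (intro tendsto_intros)
  have "(S *\<^sub>v v) \<bullet> (S *\<^sub>v v) \<le> t\<^sup>2 * (v \<bullet> v)" if t: "t > L" for t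
  proof -
    let ?T = "(1 / t) \<cdot>\<^sub>m S"
    have "?T\<^sup>T = (1 / t) \<cdot>\<^sub>m S\<^sup>T" by (intro eq_matI) auto
    hence "?T \<in> carrier_mat n n" "?T\<^sup>T = ?T" using S sym by auto
    moreover have "\<bar>x\<bar> < 1" if "eigenvalue ?T x" for x
    proof -
      have "\<bar>x / (1 / t)\<bar> \<le> L" using t L by (intro ev eigenvalue_smult_mat[OF S _ that]) auto
      hence "\<bar>x\<bar> \<le> L / t" using t L by (simp add: abs_mult field_simps)
      also have "\<dots> < 1" using t L by simp
      finally show ?thesis .
    qed
    ultimately have "(?T *\<^sub>v v) \<bullet> (?T *\<^sub>v v) \<le> v \<bullet> v"
      by (rule symmetric_mat_contraction[OF _ _ _ v])
    moreover have "?T *\<^sub>v v = (1 / t) \<cdot>\<^sub>v (S *\<^sub>v v)" using S v by auto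
    ultimately show ?thesis using t L S v by (simp add: power2_eq_square field_simps)
  qed
  thus "\<forall>\<^sub>F t in at_right L. (S *\<^sub>v v) \<bullet> (S *\<^sub>v v) \<le> t\<^sup>2 * (v \<bullet> v)"
    by (auto simp: eventually_at_filter)
qed simp

section \<open>Characteristic polynomials\<close>

lemma proots_char_poly_iff_eigenvalue:
  fixes A :: "'a :: field mat"
  assumes A: "A \<in> carrier_mat n n"
  shows "x \<in># proots (char_poly A) \<longleftrightarrow> eigenvalue A x"
proof -
  have "char_poly A \<noteq> 0" using degree_monic_char_poly[OF A] by auto
  thus ?thesis unfolding eigenvalue_root_char_poly[OF A] by simp
qed

lemma char_poly_1_by_1:
  fixes A :: "'a :: comm_ring_1 mat"
  assumes "A \<in> carrier_mat 1 1"
  shows "char_poly A = [:- (A $$ (0, 0)), 1:]"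
  using assms unfolding char_poly_defs by (subst det_single) auto

lemma det_update_invariant_columns:
  fixes M :: "'a :: idom mat"
  assumes M: "M \<in> carrier_mat n n" and U: "U \<in> carrier_mat n k" and Q: "Q \<in> carrier_mat k n"
    and D: "D \<in> carrier_mat k k" and MU: "M * U = U * D"
  shows "det D * det (M - U * Q) = det (D - Q * U) * det M"
proof -
  let ?K = "four_block_mat (1\<^sub>m k) Q U M"
  have K: "?K \<in> carrier_mat (k + n) (k + n)" using M by simp
  have UQ: "U * Q \<in> carrier_mat n n" "M - U * Q \<in> carrier_mat n n"
    and QU: "Q * U \<in> carrier_mat k k" "D - Q * U \<in> carrier_mat k k"
    using U Q by (auto intro!: minus_carrier_mat)
  have "?K * four_block_mat (1\<^sub>m k) (- Q) (0\<^sub>m n k) (1\<^sub>m n)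
      = four_block_mat (1\<^sub>m k) (0\<^sub>m k n) U (M - U * Q)"
    using M U Q UQ
    by (subst mult_four_block_mat[of _ k k _ n _ n _ _ k _ n])
      (auto intro!: cong_four_block_mat simp: comm_add_mat[of _ n n] add_uminus_minus_mat[of _ n n])
  hence "det (?K * four_block_mat (1\<^sub>m k) (- Q) (0\<^sub>m n k) (1\<^sub>m n)) = det (M - U * Q)"
    using M U UQ by (simp add: det_four_block_mat_upper_right_zero[of _ k _ n])
  hence detK: "det ?K = det (M - U * Q)"
    using K M U Q
    by (simp add: det_mult[of _ "k + n"] det_four_block_mat_lower_left_zero[of _ k _ n])
  have "D + Q * - U = D - Q * U"
    using D U Q QU by (simp add: add_uminus_minus_mat[of _ k k])
  moreover have "U * D + M * - U = 0\<^sub>m n k"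
    using M U by (simp add: MU[symmetric] add_uminus_minus_mat[of _ n k])
  ultimately have "?K * four_block_mat D (0\<^sub>m k n) (- U) (1\<^sub>m n)
      = four_block_mat (D - Q * U) Q (0\<^sub>m n k) M"
    using M U Q D by (subst mult_four_block_mat[of _ k k _ n _ n _ _ k _ n]) simp_all
  hence "det (?K * four_block_mat D (0\<^sub>m k n) (- U) (1\<^sub>m n)) = det (D - Q * U) * det M"
    using M Q QU D by (simp add: det_four_block_mat_lower_left_zero[of _ k _ n])
  thus ?thesis
    using K D U unfolding detK[symmetric]
    by (simp add: mult.commute det_mult[of _ "k + n"]
        det_four_block_mat_upper_right_zero[of _ k _ n])
qed

text \<open>Rado's extension of Brauer's theorem on rank-one updates.\<close>

lemma char_poly_update_invariant_columns:
  fixes A :: "'a :: idom mat"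
  assumes A: "A \<in> carrier_mat n n" and U: "U \<in> carrier_mat n k" and Q: "Q \<in> carrier_mat k n"
    and D: "D \<in> carrier_mat k k" and AU: "A * U = U * D"
  shows "char_poly D * char_poly (A + U * Q) = char_poly (D + Q * U) * char_poly A"
proof -
  let ?C = "map_mat (\<lambda>a. [:a:])"
  have char_poly_matrix: "char_poly_matrix B = [:0, 1:] \<cdot>\<^sub>m 1\<^sub>m m - ?C B"
    if "B \<in> carrier_mat m m" for B :: "'a mat" and m
    using that unfolding char_poly_matrix_def by (intro eq_matI) auto
  have update: "char_poly_matrix (B + X * Y) = char_poly_matrix B - ?C X * ?C Y"
    if "B \<in> carrier_mat a a" "X \<in> carrier_mat a b" "Y \<in> carrier_mat b a"
    for B X Y :: "'a mat" and a b
    unfolding map_poly_mult(1)[OF that(2,3), symmetric] using that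
    by (intro eq_matI) (auto simp: char_poly_matrix_def)
  have "char_poly_matrix A * ?C U = [:0, 1:] \<cdot>\<^sub>m ?C U - ?C (A * U)"
    using A U
    by (simp add: char_poly_matrix[OF A] map_poly_mult(1)[OF A U]
        minus_mult_distrib_mat[of _ n n] mult_smult_assoc_mat[of _ n n])
  also have "\<dots> = ?C U * char_poly_matrix D"
    using D U
    by (simp add: AU char_poly_matrix[OF D] map_poly_mult(1)[OF U D]
        mult_minus_distrib_mat[of _ n k _ k] mult_smult_distrib[of _ n k _ k])
  finally have "char_poly_matrix A * ?C U = ?C U * char_poly_matrix D" .
  thus ?thesis
    using A U Q D unfolding char_poly_def update[OF A U Q] update[OF D Q U]
    by (intro det_update_invariant_columns) auto
qed

section \<open>Discrepancy of \<open>(n, d, \<lambda>)\<close>-graphs\<close>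

lemma adjacency_mat_carrier: "adjacency_mat n adj \<in> carrier_mat n n"
  by (simp add: adjacency_mat_def)

lemma adjacency_mat_mult_vec_index:
  assumes "v \<in> carrier_vec n" "i < n"
  shows "(adjacency_mat n adj *\<^sub>v v) $ i = (\<Sum>j<n. if adj i j then v $ j else 0)"
  using assms unfolding adjacency_mat_def
  by (auto simp: scalar_prod_def atLeast0LessThan intro!: sum.cong)

lemma regular_graph_adj_sum:
  assumes G: "regular_graph n d adj" and i: "i < n"
  shows "(\<Sum>j<n. if adj i j then c else 0) = real d * c"
proof -
  have "{..<n} \<inter> {u. adj i u} = {u. adj i u}" and "card {u. adj i u} = d"
    using G i unfolding regular_graph_def simple_graph_def by auto
  thus ?thesis by (simp add: sum.If_cases)
qed

lemma adjacency_mat_mult_ones: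
  assumes G: "regular_graph n d adj"
  shows "adjacency_mat n adj *\<^sub>v vec n (\<lambda>_. 1) = real d \<cdot>\<^sub>v vec n (\<lambda>_. 1)"
proof (rule eq_vecI)
  fix i assume "i < dim_vec (real d \<cdot>\<^sub>v vec n (\<lambda>_. 1))"
  hence i: "i < n" by simp
  have "(adjacency_mat n adj *\<^sub>v vec n (\<lambda>_. 1)) $ i = (\<Sum>j<n. if adj i j then 1 else 0)"
    using i by (subst adjacency_mat_mult_vec_index) (auto intro: sum.cong)
  thus "(adjacency_mat n adj *\<^sub>v vec n (\<lambda>_. 1)) $ i = (real d \<cdot>\<^sub>v vec n (\<lambda>_. 1)) $ i"
    using regular_graph_adj_sum[OF G i, of 1] i by simp
qed (simp add: adjacency_mat_def)

lemma regular_graph_eigenvalue_le: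
  assumes reg: "regular_graph n d adj" and ev: "eigenvalue (adjacency_mat n adj) x"
  shows "\<bar>x\<bar> \<le> real d"
proof -
  obtain v where v: "v \<in> carrier_vec n" "v \<noteq> 0\<^sub>v n" "adjacency_mat n adj *\<^sub>v v = x \<cdot>\<^sub>v v"
    using ev unfolding eigenvalue_def eigenvector_def by (auto simp: adjacency_mat_def)
  then obtain k where k: "k < n" "v $ k \<noteq> 0" by (metis carrier_vecD eq_vecI index_zero_vec)
  obtain i where i: "i < n" and max: "\<And>j. j < n \<Longrightarrow> \<bar>v $ j\<bar> \<le> \<bar>v $ i\<bar>"
  proof -
    have "Max ((\<lambda>j. \<bar>v $ j\<bar>) ` {..<n}) \<in> (\<lambda>j. \<bar>v $ j\<bar>) ` {..<n}"
      using k by (intro Max_in) auto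
    then obtain i where "i < n" "Max ((\<lambda>j. \<bar>v $ j\<bar>) ` {..<n}) = \<bar>v $ i\<bar>" by auto
    thus ?thesis by (metis that Max_ge finite_imageI finite_lessThan image_eqI lessThan_iff)
  qed
  have pos: "\<bar>v $ i\<bar> > 0" using max[OF k(1)] k(2) by simp
  have "\<bar>x\<bar> * \<bar>v $ i\<bar> = \<bar>(adjacency_mat n adj *\<^sub>v v) $ i\<bar>"
    using v i by (simp add: abs_mult)
  also have "\<dots> = \<bar>\<Sum>j<n. if adj i j then v $ j else 0\<bar>"
    using adjacency_mat_mult_vec_index[OF v(1) i] by simp
  also have "\<dots> \<le> (\<Sum>j<n. \<bar>if adj i j then v $ j else 0\<bar>)" by (rule sum_abs)
  also have "\<dots> \<le> (\<Sum>j<n. if adj i j then \<bar>v $ i\<bar> else 0)"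
    using max by (intro sum_mono) auto
  also have "\<dots> = real d * \<bar>v $ i\<bar>" by (rule regular_graph_adj_sum[OF reg i])
  finally show ?thesis using pos by simp
qed

lemma Max_adjacency_eigenvalues:
  assumes G: "regular_graph n d adj" and n: "n > 0"
  shows "Max_mset (adjacency_eigenvalues n adj) = real d"
proof (rule Max_eqI)
  note eigenvalue_iff = proots_char_poly_iff_eigenvalue[OF adjacency_mat_carrier]
  have "vec n (\<lambda>_. 1 :: real) \<noteq> 0\<^sub>v n"
    using n by (metis index_vec index_zero_vec(1) zero_neq_one)
  hence "eigenvector (adjacency_mat n adj) (vec n (\<lambda>_. 1)) (real d)"
    using adjacency_mat_mult_ones[OF G] unfolding eigenvector_def by (simp add: adjacency_mat_def)
  thus "real d \<in># adjacency_eigenvalues n adj"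
    unfolding adjacency_eigenvalues_def eigenvalue_iff eigenvalue_def by blast
  show "x \<le> real d" if "x \<in># adjacency_eigenvalues n adj" for x
    using that regular_graph_eigenvalue_le[OF G]
    unfolding adjacency_eigenvalues_def eigenvalue_iff by fastforce
qed simp

definition deflated_adjacency_mat :: "nat \<Rightarrow> nat \<Rightarrow> (nat \<Rightarrow> nat \<Rightarrow> bool) \<Rightarrow> real mat" where
  "deflated_adjacency_mat n d adj =
     mat n n (\<lambda>(i, j). (if adj i j then 1 else 0) - real d / real n)"

lemma deflated_adjacency_mat_carrier: "deflated_adjacency_mat n d adj \<in> carrier_mat n n"
  by (simp add: deflated_adjacency_mat_def)

lemma deflated_adjacency_mat_symmetric:
  assumes "simple_graph n adj"
  shows "(deflated_adjacency_mat n d adj)\<^sup>T = deflated_adjacency_mat n d adj"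
  using assms unfolding deflated_adjacency_mat_def simple_graph_def
  by (intro eq_matI) auto

lemma char_poly_deflated_adjacency_mat:
  assumes G: "regular_graph n d adj" and n: "n > 0"
  shows "[:- real d, 1:] * char_poly (deflated_adjacency_mat n d adj) =
    [:0, 1:] * char_poly (adjacency_mat n adj)"
proof -
  let ?A = "adjacency_mat n adj"
  let ?U = "mat n 1 (\<lambda>_. 1 :: real)" and ?Q = "mat 1 n (\<lambda>_. - (real d / real n))"
  let ?D = "mat 1 1 (\<lambda>_. real d)"
  have "?A * ?U = ?U * ?D"
  proof (rule eq_matI)
    fix i j assume "i < dim_row (?U * ?D)" "j < dim_col (?U * ?D)"
    hence i: "i < n" and j: "j = 0" by auto
    have "(?A * ?U) $$ (i, j) = (?A *\<^sub>v vec n (\<lambda>_. 1)) $ i"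
      using i j by (simp add: adjacency_mat_def scalar_prod_def)
    also have "\<dots> = (?U * ?D) $$ (i, j)"
      using i j by (simp add: adjacency_mat_mult_ones[OF G] scalar_prod_def)
    finally show "(?A * ?U) $$ (i, j) = (?U * ?D) $$ (i, j)" .
  qed (simp_all add: adjacency_mat_def)
  hence "char_poly ?D * char_poly (?A + ?U * ?Q) = char_poly (?D + ?Q * ?U) * char_poly ?A"
    by (intro char_poly_update_invariant_columns[OF adjacency_mat_carrier]) auto
  moreover have "?A + ?U * ?Q = deflated_adjacency_mat n d adj"
    unfolding adjacency_mat_def deflated_adjacency_mat_def
    by (intro eq_matI) (auto simp: scalar_prod_def)
  moreover have "?D + ?Q * ?U = 0\<^sub>m 1 1"
    using n by (intro eq_matI) (auto simp: scalar_prod_def)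
  ultimately show ?thesis by (simp add: char_poly_1_by_1 del: mult_pCons_left mult_pCons_right)
qed

lemma deflated_adjacency_eigenvalue_le:
  assumes G: "ndl_graph n d l adj" and ev: "eigenvalue (deflated_adjacency_mat n d adj) x"
    and x: "x \<noteq> 0"
  shows "\<bar>x\<bar> \<le> l"
proof -
  let ?A = "adjacency_mat n adj" and ?B = "deflated_adjacency_mat n d adj"
  let ?E = "adjacency_eigenvalues n adj"
  have reg: "regular_graph n d adj" using G unfolding ndl_graph_def by simp
  have n: "n > 0" by (rule eigenvalue_imp_nonzero_dim[OF deflated_adjacency_mat_carrier ev])
  have nz: "char_poly ?A \<noteq> 0" "char_poly ?B \<noteq> 0"
    using degree_monic_char_poly[OF adjacency_mat_carrier]
      degree_monic_char_poly[OF deflated_adjacency_mat_carrier] by (metis coeff_0 zero_neq_one)+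
  have "proots ([:- real d, 1:] * char_poly ?B) = proots ([:0, 1:] * char_poly ?A)"
    by (simp only: char_poly_deflated_adjacency_mat[OF reg n])
  hence "add_mset (real d) (proots (char_poly ?B)) = add_mset 0 ?E"
    using nz
    by (simp add: proots_mult adjacency_eigenvalues_def
        del: mult_pCons_left mult_pCons_right)
  hence "count (add_mset (real d) (proots (char_poly ?B))) x = count ?E x" using x by simp
  moreover have "x \<in># proots (char_poly ?B)"
    using ev proots_char_poly_iff_eigenvalue[OF deflated_adjacency_mat_carrier] by blast
  hence "count (proots (char_poly ?B)) x > 0" by (simp only: count_greater_zero_iff)
  ultimately have "x \<in># ?E - {#real d#}"
    unfolding in_diff_count by (simp del: count_greater_zero_iff split: if_splits)
  thus ?thesis using G unfolding ndl_graph_def Max_adjacency_eigenvalues[OF reg n] by blast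
qed

definition nbr_discrepancy :: "('a \<Rightarrow> 'a \<Rightarrow> bool) \<Rightarrow> real \<Rightarrow> 'a set \<Rightarrow> 'a \<Rightarrow> real" where
  "nbr_discrepancy adj p W u = real (card {w \<in> W. adj u w}) - p * real (card W)"

lemma deflated_adjacency_mat_mult_indicator:
  assumes W: "W \<subseteq> {..<n}" and u: "u < n"
  shows "(deflated_adjacency_mat n d adj *\<^sub>v vec n (indicator W)) $ u =
    nbr_discrepancy adj (real d / real n) W u"
proof -
  have fin: "finite W" using W finite_subset by blast
  have "(deflated_adjacency_mat n d adj *\<^sub>v vec n (indicator W)) $ u =
      (\<Sum>w<n. ((if adj u w then 1 else 0) - real d / real n) * indicator W w)"
    using u
    by (auto simp: deflated_adjacency_mat_def scalar_prod_def atLeast0LessThan intro!: sum.cong)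
  also have "\<dots> = (\<Sum>w\<in>W. (if adj u w then 1 else 0) - real d / real n)"
    using W by (intro sum.mono_neutral_cong_right) (auto simp: indicator_def)
  also have "\<dots> = nbr_discrepancy adj (real d / real n) W u"
    using fin by (simp add: nbr_discrepancy_def sum_subtractf sum.If_cases Int_def)
  finally show ?thesis .
qed

lemma ndl_graph_sum_sq_discrepancy_le:
  assumes G: "ndl_graph n d l adj" and W: "W \<subseteq> {..<n}"
  shows "(\<Sum>u<n. (nbr_discrepancy adj (real d / real n) W u)\<^sup>2) \<le> (max l 0)\<^sup>2 * real (card W)"
proof -
  let ?B = "deflated_adjacency_mat n d adj" and ?w = "vec n (indicator W) :: real vec"
  have "simple_graph n adj" using G by (simp add: ndl_graph_def regular_graph_def)
  moreover have "\<bar>x\<bar> \<le> max l 0" if "eigenvalue ?B x" for x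
    using deflated_adjacency_eigenvalue_le[OF G that] by (cases "x = 0") auto
  ultimately have "(?B *\<^sub>v ?w) \<bullet> (?B *\<^sub>v ?w) \<le> (max l 0)\<^sup>2 * (?w \<bullet> ?w)"
    by (intro symmetric_mat_sq_norm_le[OF deflated_adjacency_mat_carrier
          deflated_adjacency_mat_symmetric]) auto
  moreover have "(?B *\<^sub>v ?w) \<bullet> (?B *\<^sub>v ?w) =
      (\<Sum>u<n. (nbr_discrepancy adj (real d / real n) W u)\<^sup>2)"
    unfolding scalar_prod_def using deflated_adjacency_mat_carrier[of n d adj]
    by (auto simp: deflated_adjacency_mat_mult_indicator[OF W] atLeast0LessThan
        power2_eq_square simp del: index_mult_mat_vec)
  moreover have "?w \<bullet> ?w = (\<Sum>w\<in>W. 1)"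
    unfolding scalar_prod_def using W
    by (auto simp: atLeast0LessThan Int_absorb1)
  ultimately show ?thesis by simp
qed

locale discrepancy_graph =
  fixes V :: "'a set" and adj :: "'a \<Rightarrow> 'a \<Rightarrow> bool" and p L :: real
  assumes finite_V: "finite V"
    and adj_sym: "adj u v \<Longrightarrow> adj v u"
    and sum_sq_discrepancy_le:
      "W \<subseteq> V \<Longrightarrow> (\<Sum>u\<in>V. (nbr_discrepancy adj p W u)\<^sup>2) \<le> L\<^sup>2 * real (card W)"
begin

lemma card_large_discrepancy_le:
  assumes W: "W \<subseteq> V" and T: "T \<subseteq> V" and c: "0 \<le> c"
    and large: "\<And>u. u \<in> T \<Longrightarrow> c \<le> \<bar>nbr_discrepancy adj p W u\<bar>"
  shows "real (card T) * c\<^sup>2 \<le> L\<^sup>2 * real (card W)"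
proof -
  have "real (card T) * c\<^sup>2 = (\<Sum>u\<in>T. c\<^sup>2)" by simp
  also have "\<dots> \<le> (\<Sum>u\<in>T. (nbr_discrepancy adj p W u)\<^sup>2)"
    using c large by (intro sum_mono) (metis abs_le_square_iff abs_of_nonneg)
  also have "\<dots> \<le> (\<Sum>u\<in>V. (nbr_discrepancy adj p W u)\<^sup>2)"
    using finite_V T by (intro sum_mono2) auto
  also have "\<dots> \<le> L\<^sup>2 * real (card W)" by (rule sum_sq_discrepancy_le[OF W])
  finally show ?thesis .
qed

lemma density_sq_le:
  assumes v: "v \<in> V" "\<not> adj v v"
  shows "p\<^sup>2 \<le> L\<^sup>2"
proof -
  have "{w \<in> {v}. adj v w} = {}" using v(2) by auto
  hence "nbr_discrepancy adj p {v} v = - p" by (simp add: nbr_discrepancy_def)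
  thus ?thesis using card_large_discrepancy_le[of "{v}" "{v}" "\<bar>p\<bar>"] v(1) by simp
qed

lemma card_common_nbrs_le:
  assumes S: "S \<subseteq> V" and p: "p \<le> 1 / 2"
  shows "real (card S) * real (card {x \<in> V. \<forall>w\<in>S. adj x w}) \<le> 4 * L\<^sup>2"
proof (cases "S = {}")
  case False
  let ?T = "{x \<in> V. \<forall>w\<in>S. adj x w}"
  define s where "s = real (card S)"
  have s: "s > 0" using S False finite_V finite_subset unfolding s_def by (auto simp: card_gt_0_iff)
  have "s / 2 \<le> \<bar>nbr_discrepancy adj p S x\<bar>" if "x \<in> ?T" for x
  proof -
    have "{w \<in> S. adj x w} = S" using that by auto
    hence "nbr_discrepancy adj p S x = (1 - p) * s"
      by (simp add: nbr_discrepancy_def s_def algebra_simps)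
    moreover have "1 / 2 * s \<le> (1 - p) * s" using p s by (intro mult_right_mono) auto
    ultimately show ?thesis by simp
  qed
  hence "real (card ?T) * (s / 2)\<^sup>2 \<le> L\<^sup>2 * s"
    using S s unfolding s_def by (intro card_large_discrepancy_le) auto
  hence "s * (s * real (card ?T)) \<le> s * (4 * L\<^sup>2)"
    by (simp add: power2_eq_square field_simps)
  thus ?thesis using s unfolding s_def[symmetric] by simp
qed simp

end

section \<open>Shattered triples\<close>

text \<open>
  The constant must exceed \<open>12 \<cdot> 128\<close>: at most \<open>12 L\<^sup>2 N\<^sup>2\<close> covered stars have to be outnumbered by
  at least \<open>p\<^sup>3 N\<^sup>4 / 128\<close> typical ones.
\<close>

locale discrepancy_subset = discrepancy_graph +
  fixes U :: "'a set"
  assumes p: "0 < p" "p \<le> 1 / 5"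
    and U: "U \<subseteq> V" "U \<noteq> {}"
    and U_large: "1600 * L\<^sup>2 \<le> p ^ 3 * (real (card U))\<^sup>2"
begin

abbreviation N :: real where "N \<equiv> real (card U)"

definition nbrs :: "'a \<Rightarrow> 'a set" where
  "nbrs y = {w \<in> U. adj y w}"

definition typical :: "'a set" where
  "typical = {y \<in> U. \<bar>nbr_discrepancy adj p U y\<bar> \<le> p * N / 2}"

lemma finite_U: "finite U"
  using U(1) finite_V finite_subset by blast

lemma N_pos: "N > 0"
  using U(2) finite_U by (simp add: card_gt_0_iff)

lemma nbrs_subset: "nbrs y \<subseteq> U"
  by (auto simp: nbrs_def)

lemma typical_subset: "typical \<subseteq> U"
  by (auto simp: typical_def)

lemma finite_nbrs: "finite (nbrs y)"
  using nbrs_subset finite_U finite_subset by blast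

lemma finite_typical: "finite typical"
  using typical_subset finite_U finite_subset by blast

lemma card_atypical_le: "real (card (U - typical)) \<le> p * N / 400"
proof -
  have "real (card (U - typical)) * (p * N / 2)\<^sup>2 \<le> L\<^sup>2 * N"
    using U p by (intro card_large_discrepancy_le) (auto simp: typical_def)
  also have "\<dots> \<le> (p ^ 3 * N\<^sup>2 / 1600) * N" using U_large by (intro mult_right_mono) auto
  also have "\<dots> = (p * N / 400) * (p * N / 2)\<^sup>2" by (simp add: power2_eq_square power3_eq_cube)
  finally show ?thesis using p N_pos by (simp add: mult_le_cancel_right)
qed

lemma card_typical_ge: "N / 2 \<le> real (card typical)"
proof -
  have "N - real (card typical) = real (card (U - typical))"
    using card_mono[OF finite_U typical_subset]
    by (simp add: card_Diff_subset[OF finite_typical typical_subset])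
  also have "\<dots> \<le> p * N / 400" by (rule card_atypical_le)
  also have "\<dots> \<le> 1 * N / 400" using p by (intro divide_right_mono mult_right_mono) auto
  finally show ?thesis using N_pos by linarith
qed

lemma card_nbrs_typical:
  assumes "y \<in> typical"
  shows "p * N / 2 \<le> real (card (nbrs y))" "real (card (nbrs y)) \<le> 3 / 2 * (p * N)"
proof -
  have "\<bar>real (card (nbrs y)) - p * N\<bar> \<le> p * N / 2"
    using assms unfolding typical_def nbr_discrepancy_def nbrs_def by auto
  thus "p * N / 2 \<le> real (card (nbrs y))" "real (card (nbrs y)) \<le> 3 / 2 * (p * N)" by linarith+
qed

lemma card_typical_nbrs_ge:
  assumes "y \<in> typical"
  shows "p * N / 4 \<le> real (card (nbrs y \<inter> typical))"
proof -
  have "p * N / 2 \<le> real (card (nbrs y))" by (rule card_nbrs_typical(1)[OF assms])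
  also have "card (nbrs y) \<le> card (nbrs y \<inter> typical) + card (U - typical)"
    using finite_nbrs finite_U finite_typical nbrs_subset
    by (intro order.trans[OF card_mono card_Un_le]) auto
  hence "real (card (nbrs y)) \<le> real (card (nbrs y \<inter> typical)) + real (card (U - typical))"
    by linarith
  also have "\<dots> \<le> real (card (nbrs y \<inter> typical)) + p * N / 400" using card_atypical_le by simp
  finally show ?thesis using p N_pos by (simp add: mult_pos_pos)
qed

definition typical_stars :: "('a \<times> 'a \<times> 'a \<times> 'a) set" where
  "typical_stars =
    (SIGMA y : typical. (nbrs y \<inter> typical) \<times> (nbrs y \<inter> typical) \<times> (nbrs y \<inter> typical))"

lemma card_typical_stars_ge: "p ^ 3 * N ^ 4 / 128 \<le> real (card typical_stars)"
proof -
  have pN: "0 \<le> p * N / 4" using p N_pos by simp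
  have "p ^ 3 * N ^ 4 / 128 = N / 2 * (p * N / 4) ^ 3"
    by (simp add: power3_eq_cube power4_eq_xxxx)
  also have "\<dots> \<le> real (card typical) * (p * N / 4) ^ 3"
    using card_typical_ge pN by (intro mult_right_mono) auto
  also have "\<dots> = (\<Sum>y\<in>typical. (p * N / 4) ^ 3)" by simp
  also have "\<dots> \<le> (\<Sum>y\<in>typical. real (card (nbrs y \<inter> typical)) ^ 3)"
    using card_typical_nbrs_ge pN by (intro sum_mono power_mono) auto
  also have "\<dots> = real (card typical_stars)"
    unfolding typical_stars_def using finite_typical
    by (subst card_SigmaI) (auto simp: card_cartesian_product power3_eq_cube mult.assoc)
  finally show ?thesis .
qed

text \<open>
  Stars with \<open>c \<in> {a, b}\<close> are included on purpose: the leaves of a star that is uncovered in every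
  order are then distinct.
\<close>

definition covered_stars :: "('a \<times> 'a \<times> 'a \<times> 'a) set" where
  "covered_stars = {(y, a, b, c). y \<in> nbrs a \<inter> nbrs b \<and> a \<in> U \<and> b \<in> U \<and> c \<in> U \<and>
     nbrs a \<inter> nbrs b \<subseteq> nbrs c}"

lemma finite_covered_stars: "finite covered_stars"
  using finite_U nbrs_subset
  by (intro finite_subset[of covered_stars "U \<times> U \<times> U \<times> U"]) (auto simp: covered_stars_def)

lemma card_covered_stars_le: "real (card covered_stars) \<le> 4 * L\<^sup>2 * N\<^sup>2"
proof -
  let ?S = "\<lambda>(a, b). nbrs a \<inter> nbrs b"
  let ?T = "\<lambda>S. {c \<in> U. S \<subseteq> nbrs c}"
  let ?I = "SIGMA q : U \<times> U. ?S q \<times> ?T (?S q)"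
  have finS: "finite (?S q)" for q using finite_nbrs by (cases q) auto
  have "bij_betw (\<lambda>((a, b), (y, c)). (y, a, b, c)) ?I covered_stars"
    by (intro bij_betwI[where g = "\<lambda>(y, a, b, c). ((a, b), (y, c))"]) (auto simp: covered_stars_def)
  hence "real (card covered_stars) = real (card ?I)" by (simp add: bij_betw_same_card)
  also have "\<dots> = (\<Sum>q\<in>U \<times> U. real (card (?S q)) * real (card (?T (?S q))))"
    using finite_U finS by (subst card_SigmaI) (auto simp: card_cartesian_product)
  also have "\<dots> \<le> (\<Sum>q\<in>U \<times> U. 4 * L\<^sup>2)"
  proof (intro sum_mono)
    fix q
    have S: "?S q \<subseteq> U" using nbrs_subset by (cases q) auto
    have "card (?T (?S q)) \<le> card {x \<in> V. \<forall>w\<in>?S q. adj x w}"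
      using finite_V U by (intro card_mono) (auto simp: nbrs_def)
    hence "real (card (?S q)) * real (card (?T (?S q)))
        \<le> real (card (?S q)) * real (card {x \<in> V. \<forall>w\<in>?S q. adj x w})"
      by (intro mult_left_mono) auto
    also have "\<dots> \<le> 4 * L\<^sup>2" using S U p by (intro card_common_nbrs_le) auto
    finally show "real (card (?S q)) * real (card (?T (?S q))) \<le> 4 * L\<^sup>2" .
  qed
  also have "\<dots> = 4 * L\<^sup>2 * N\<^sup>2" by (simp add: card_cartesian_product power2_eq_square)
  finally show ?thesis .
qed

lemma uncovered_typical_star_exists:
  obtains y a b c where "(y, a, b, c) \<in> typical_stars"
    "(y, a, b, c) \<notin> covered_stars" "(y, a, c, b) \<notin> covered_stars" "(y, b, c, a) \<notin> covered_stars"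
proof -
  let ?f = "\<lambda>(y, a, b, c). (y, a, c, b)" and ?g = "\<lambda>(y, a, b, c). (y, b, c, a)"
  let ?bad = "covered_stars \<union> ?f -` covered_stars \<union> ?g -` covered_stars"
  have inj: "inj ?f" "inj ?g" by (auto simp: inj_on_def)
  have fin: "finite ?bad"
    using finite_covered_stars inj by (intro finite_UnI finite_vimageI) auto
  have "card (h -` covered_stars) \<le> card covered_stars" if "inj h" for h
    using card_vimage_inj_on_le[OF that finite_covered_stars] by simp
  note card_vimage = this[OF inj(1)] this[OF inj(2)]
  have "real (card ?bad) \<le> real (card covered_stars + card covered_stars + card covered_stars)"
    by (intro of_nat_mono order.trans[OF card_Un_le] add_mono card_vimage order.refl)
  also have "\<dots> \<le> 12 * L\<^sup>2 * N\<^sup>2" using card_covered_stars_le by simp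
  also have "\<dots> \<le> 12 * (p ^ 3 * N\<^sup>2 / 1600) * N\<^sup>2"
    using U_large by (intro mult_right_mono mult_left_mono) auto
  also have "\<dots> = 12 / 1600 * (p ^ 3 * N ^ 4)" by (simp add: power2_eq_square power4_eq_xxxx)
  also have "\<dots> < 1 / 128 * (p ^ 3 * N ^ 4)" using p N_pos by (intro mult_strict_right_mono) auto
  also have "\<dots> \<le> real (card typical_stars)" using card_typical_stars_ge by simp
  finally have "card ?bad < card typical_stars" by simp
  hence "\<not> typical_stars \<subseteq> ?bad" using card_mono[OF fin] leD by blast
  then obtain q where q: "q \<in> typical_stars" "q \<notin> ?bad" by blast
  obtain y a b c where "q = (y, a, b, c)" by (cases q)
  thus thesis using q that[of y a b c] by simp
qed

lemma typical_triple_common_nonnbr: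
  assumes "a \<in> typical" "b \<in> typical" "c \<in> typical"
  obtains z where "z \<in> U" "z \<notin> nbrs a" "z \<notin> nbrs b" "z \<notin> nbrs c"
proof -
  have "real (card (nbrs a \<union> nbrs b \<union> nbrs c))
      \<le> real (card (nbrs a) + card (nbrs b) + card (nbrs c))"
    by (intro of_nat_mono order.trans[OF card_Un_le] add_mono card_Un_le) auto
  also have "\<dots> \<le> 9 / 2 * (p * N)"
    using assms[THEN card_nbrs_typical(2)] by simp
  also have "p * N \<le> 1 / 5 * N" using p by (intro mult_right_mono) auto
  hence "9 / 2 * (p * N) < N" using N_pos by linarith
  finally have "\<not> U \<subseteq> nbrs a \<union> nbrs b \<union> nbrs c"
    using card_mono[of "nbrs a \<union> nbrs b \<union> nbrs c" U] finite_nbrs by auto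
  thus thesis using that by blast
qed

lemma full_trace_triple_exists:
  assumes isolating: "\<And>a b c. a \<in> U \<Longrightarrow> b \<in> U \<Longrightarrow> c \<in> U \<Longrightarrow> distinct [a, b, c] \<Longrightarrow>
    \<exists>u\<in>U. adj u a \<and> \<not> adj u b \<and> \<not> adj u c"
  obtains a b c where "{a, b, c} \<subseteq> U" "distinct [a, b, c]"
    "\<And>P Q R. \<exists>v\<in>U. (adj a v \<longleftrightarrow> P) \<and> (adj b v \<longleftrightarrow> Q) \<and> (adj c v \<longleftrightarrow> R)"
proof -
  have sym: "adj u v \<longleftrightarrow> adj v u" for u v using adj_sym by blast
  obtain y a b c where star: "(y, a, b, c) \<in> typical_stars"
    and uncovered: "(y, a, b, c) \<notin> covered_stars" "(y, a, c, b) \<notin> covered_stars"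
      "(y, b, c, a) \<notin> covered_stars"
    by (rule uncovered_typical_star_exists)
  have typical: "a \<in> typical" "b \<in> typical" "c \<in> typical" and y: "y \<in> U"
    and adj_y: "adj y a" "adj y b" "adj y c"
    using star typical_subset by (auto simp: typical_stars_def nbrs_def)
  have inU: "a \<in> U" "b \<in> U" "c \<in> U" using typical typical_subset by auto
  have ab: "\<not> nbrs a \<inter> nbrs b \<subseteq> nbrs c" and ac: "\<not> nbrs a \<inter> nbrs c \<subseteq> nbrs b"
    and bc: "\<not> nbrs b \<inter> nbrs c \<subseteq> nbrs a"
    using uncovered inU y adj_y sym by (auto simp: covered_stars_def nbrs_def)
  hence dist: "distinct [a, b, c]" by auto
  have "\<exists>v\<in>U. \<not> adj a v \<and> \<not> adj b v \<and> \<not> adj c v"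
    using typical_triple_common_nonnbr[OF typical] by (auto simp: nbrs_def)
  moreover have "\<exists>v\<in>U. adj a v \<and> adj b v \<and> adj c v" using y adj_y sym by blast
  moreover have "\<exists>v\<in>U. adj a v \<and> adj b v \<and> \<not> adj c v" using ab by (auto simp: nbrs_def)
  moreover have "\<exists>v\<in>U. adj a v \<and> \<not> adj b v \<and> adj c v" using ac by (auto simp: nbrs_def)
  moreover have "\<exists>v\<in>U. \<not> adj a v \<and> adj b v \<and> adj c v" using bc by (auto simp: nbrs_def)
  moreover have "\<exists>v\<in>U. adj a v \<and> \<not> adj b v \<and> \<not> adj c v"
    "\<exists>v\<in>U. \<not> adj a v \<and> adj b v \<and> \<not> adj c v" "\<exists>v\<in>U. \<not> adj a v \<and> \<not> adj b v \<and> adj c v"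
    using isolating[of a b c] isolating[of b a c] isolating[of c a b] inU dist sym by auto
  ultimately have "\<exists>v\<in>U. (adj a v \<longleftrightarrow> P) \<and> (adj b v \<longleftrightarrow> Q) \<and> (adj c v \<longleftrightarrow> R)" for P Q R
    by (cases P; cases Q; cases R) simp_all
  thus thesis using that inU dist by simp
qed

end

lemma shatters_nbr_class:
  assumes X: "X \<subseteq> U"
    and traces: "\<And>S. S \<subseteq> X \<Longrightarrow> \<exists>v\<in>U. \<forall>x\<in>X. adj x v \<longleftrightarrow> x \<in> S"
  shows "shatters (nbr_class adj U) X"
  unfolding shatters_def
proof (intro equalityI subsetI)
  fix f assume "f \<in> (\<lambda>h. restrict h X) ` nbr_class adj U"
  thus "f \<in> X \<rightarrow>\<^sub>E {0, 1}"
    using X unfolding nbr_class_def nbr_fun_def by auto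
next
  fix f assume f: "f \<in> X \<rightarrow>\<^sub>E {0, 1 :: nat}"
  obtain v where v: "v \<in> U" "\<And>x. x \<in> X \<Longrightarrow> adj x v \<longleftrightarrow> f x = 1"
    using traces[of "{x \<in> X. f x = 1}"] by auto
  have "restrict (nbr_fun adj U v) X = f"
  proof
    fix x
    show "restrict (nbr_fun adj U v) X x = f x"
      using v(2)[of x] f X
      by (cases "x \<in> X") (auto simp: nbr_fun_def PiE_def Pi_def extensional_def)
  qed
  thus "f \<in> (\<lambda>h. restrict h X) ` nbr_class adj U"
    unfolding nbr_class_def using v(1) by (metis image_eqI)
qed

lemma vc_dim_nbr_class_ge_card:
  assumes "finite X" "X \<subseteq> U"
    and "\<And>S. S \<subseteq> X \<Longrightarrow> \<exists>v\<in>U. \<forall>x\<in>X. adj x v \<longleftrightarrow> x \<in> S"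
  shows "enat (card X) \<le> vc_dim U (nbr_class adj U)"
  unfolding vc_dim_def by (rule Sup_upper) (use assms shatters_nbr_class in blast)

lemma ndl_graph_discrepancy_graph:
  assumes "ndl_graph n d l adj"
  shows "discrepancy_graph {..<n} adj (real d / real n) (max l 0)"
  using assms ndl_graph_sum_sq_discrepancy_le[OF assms]
  unfolding ndl_graph_def regular_graph_def simple_graph_def by unfold_locales auto

lemma ndl_graph_eigenvalue_bound_pos:
  assumes G: "ndl_graph n d l adj" and "0 < d" "d \<le> n"
  shows "0 < l"
proof -
  interpret discrepancy_graph "{..<n}" adj "real d / real n" "max l 0"
    by (rule ndl_graph_discrepancy_graph[OF G])
  have "(real d / real n)\<^sup>2 \<le> (max l 0)\<^sup>2"
    using assms by (intro density_sq_le[of 0])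
      (auto simp: ndl_graph_def regular_graph_def simple_graph_def)
  moreover have "0 < (real d / real n)\<^sup>2" using assms(2,3) by simp
  ultimately show ?thesis by (auto simp: max_def divide_le_0_iff split: if_splits)
qed

lemma ndl_graph_vc_dim_ge_3:
  assumes G: "ndl_graph n d l adj" and d: "0 < d" "5 * d \<le> n" and U: "U \<subseteq> {..<n}"
    and isolating: "\<And>a b c. a \<in> U \<Longrightarrow> b \<in> U \<Longrightarrow> c \<in> U \<Longrightarrow> distinct [a, b, c] \<Longrightarrow>
      \<exists>u\<in>U. adj u a \<and> \<not> adj u b \<and> \<not> adj u c"
    and size: "40 * l * (real n / real d) powr (3/2) \<le> real (card U)"
  shows "vc_dim U (nbr_class adj U) \<ge> 3"
proof -
  define p r where "p = real d / real n" and "r = real n / real d"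
  have l: "l > 0" using d by (intro ndl_graph_eigenvalue_bound_pos[OF G]) auto
  have p: "0 < p" "p \<le> 1 / 5" and r: "r > 0" "p * r = 1"
    using d unfolding p_def r_def by (auto simp: field_simps)
  have pos: "0 < 40 * l * r powr (3/2)" using l r(1) by simp
  have "(r powr (3/2))\<^sup>2 = r ^ 3" using r(1) by (simp add: powr_power powr_numeral)
  hence "1600 * l\<^sup>2 = p ^ 3 * (40 * l * r powr (3/2))\<^sup>2"
    using r(2) by (simp add: power_mult_distrib mult.left_commute flip: power_mult_distrib[of p r])
  also have "\<dots> \<le> p ^ 3 * (real (card U))\<^sup>2"
    using size pos p unfolding r_def by (intro mult_left_mono power_mono) auto
  finally have large: "1600 * (max l 0)\<^sup>2 \<le> p ^ 3 * (real (card U))\<^sup>2" using l by simp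
  have "U \<noteq> {}" using size pos unfolding r_def by auto
  then interpret discrepancy_subset "{..<n}" adj p "max l 0" U
    using ndl_graph_discrepancy_graph[OF G, folded p_def] p U large
    by (simp add: discrepancy_subset_def discrepancy_subset_axioms_def)
  obtain a b c where abc: "{a, b, c} \<subseteq> U" "distinct [a, b, c]"
    and traces: "\<And>P Q R. \<exists>v\<in>U. (adj a v \<longleftrightarrow> P) \<and> (adj b v \<longleftrightarrow> Q) \<and> (adj c v \<longleftrightarrow> R)"
    using full_trace_triple_exists[OF isolating] by blast
  have "\<exists>v\<in>U. \<forall>x\<in>{a, b, c}. adj x v \<longleftrightarrow> x \<in> S" for S
    using traces[of "a \<in> S" "b \<in> S" "c \<in> S"] by simp
  hence "enat (card {a, b, c}) \<le> vc_dim U (nbr_class adj U)"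
    using abc(1) by (intro vc_dim_nbr_class_ge_card) auto
  moreover have "card {a, b, c} = 3" using abc(2) by simp
  ultimately show ?thesis by (simp add: numeral_eq_enat)
qed

theorem theorem1p5:
  shows "\<exists>C::real. C > 0 \<and>
    (\<forall>(n :: nat \<Rightarrow> nat) (d :: nat \<Rightarrow> nat) (l :: nat \<Rightarrow> real)
      (adj :: nat \<Rightarrow> nat \<Rightarrow> nat \<Rightarrow> bool) (U :: nat \<Rightarrow> nat set).
      filterlim n at_top sequentially \<longrightarrow>
      (\<lambda>k. real (d k)) \<in> o(\<lambda>k. real (n k)) \<longrightarrow>
      (\<forall>k. d k > 0) \<longrightarrow>
      (\<forall>k. ndl_graph (n k) (d k) (l k) (adj k)) \<longrightarrow>
      (\<forall>k. U k \<subseteq> {..<n k}) \<longrightarrow>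
      (\<forall>k. \<forall>v1\<in>U k. \<forall>v2\<in>U k. \<forall>v3\<in>U k. distinct [v1, v2, v3] \<longrightarrow>
        (\<exists>u1\<in>U k. \<exists>u2\<in>U k. \<exists>u3\<in>U k.
          adj k u1 v1 \<and> \<not> adj k u1 v2 \<and> \<not> adj k u1 v3 \<and>
          \<not> adj k u2 v1 \<and> adj k u2 v2 \<and> \<not> adj k u2 v3 \<and>
          \<not> adj k u3 v1 \<and> \<not> adj k u3 v2 \<and> adj k u3 v3)) \<longrightarrow>
      (\<forall>k. real (card (U k)) \<ge>
        C * max (l k powr (2/3) * (real (n k) / real (d k))\<^sup>2)
                (l k * (real (n k) / real (d k)) powr (13/7))) \<longrightarrow>
      (\<forall>\<^sub>F k in sequentially. vc_dim (U k) (nbr_class (adj k) (U k)) \<ge> 3))"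
proof (intro exI[of _ 40] conjI allI impI, goal_cases constant_pos vc_dim_ge_3)
  case (vc_dim_ge_3 n d l adj U)
  note sparse = vc_dim_ge_3(2) and d = vc_dim_ge_3(3)[rule_format]
    and G = vc_dim_ge_3(4)[rule_format] and U = vc_dim_ge_3(5)[rule_format]
    and isolating = vc_dim_ge_3(6)[rule_format] and size = vc_dim_ge_3(7)[rule_format]
  have "\<forall>\<^sub>F k in sequentially. norm (real (d k)) \<le> 1 / 5 * norm (real (n k))"
    by (rule landau_o.smallD[OF sparse]) simp
  thus ?case
  proof eventually_elim
    case (elim k)
    let ?r = "real (n k) / real (d k)"
    have dn: "d k \<le> n k" "5 * d k \<le> n k" using elim by auto
    have "40 * l k * ?r powr (3/2) \<le> 40 * l k * ?r powr (13/7)"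
      using ndl_graph_eigenvalue_bound_pos[OF G d dn(1)] d[of k] dn(1)
      by (intro mult_left_mono powr_mono) auto
    also have "\<dots> \<le> real (card (U k))" using size[of k] by linarith
    finally show ?case
      using isolating by (intro ndl_graph_vc_dim_ge_3[OF G d dn(2) U]) blast+
  qed
qed simp

end
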